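(* Let $A\in\mathbb{R}^{m\times n}$ have full column rank and let $b\in\mathbb{R}^m$. Let $\mathcal{D}$ be a distribution of random matrix quadruples $(S_1,S_2,T_1,T_2)$ satisfying $\mathbb{E}[T_1T_2^\top A^\top S_1S_2^\top]=\frac{A^\top}{\|A\|_F^2}$. Let $x^1=x^0\in\mathbb{R}^n$ be (deterministic) initial vectors and let $\{x^k\}$ be generated by the mPFR iteration $$x^{k+1}=x^{k}-\alpha T_1T_2^\top A^\top S_1S_2^\top(Ax^{k}-b)+\omega(x^k-x^{k-1}),\qquad k\ge 1,$$ where at each iteration a fresh quadruple $(S_1,S_2,T_1,T_2)$ is drawn independently from $\mathcal{D}$. Denote $$\beta_1=\|\mathbb{E}[ S_2S_1^\top AT_2T_1^\top T_1T_2^\top A^\top S_1S_2^\top ]\|_2.$$ Assume $0<\alpha<\frac{1}{\beta_1\|A\|^2_F}$, $\omega\geq0$, and that the expressions $$\gamma_1=1+3\omega+2\omega^2-(2\alpha+\alpha\omega-2\alpha^2\beta_1\|A\|^2_F)\frac{\sigma^2_{\min}(A)}{\|A\|^2_F}\quad\text{and}\quad\gamma_2=2\omega^2+\omega+\omega\alpha\frac{\sigma^2_{\max}(A)}{\|A\|^2_F}$$ satisfy $\gamma_1+\gamma_2<1$. Then $$\mathbb{E}[\|x^{k+1}-A^{\dagger}b\|^2_2]\leq q^k(1+\tau)\|x^0-A^{\dagger}b\|^2_2+\frac{2\alpha^2\beta_1(1-q^k)\|AA^{\dagger}b-b\|^2_2}{1-q}\qquad\text{for all } k\geq0,$$ where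 $q=\frac{\gamma_1+\sqrt{\gamma_1^2+4\gamma_2}}{2}$ if $\omega>0$, $q=\gamma_1$ if $\omega=0$, and $\tau=q-\gamma_1\geq 0$. Moreover, $\gamma_1+\gamma_2\leq q<1$.
   Context: $A^\dagger$ is the Moore-Penrose pseudoinverse; $\|\cdot\|_F$ is the Frobenius norm; $\|\cdot\|_2$ is the Euclidean norm of a vector or the spectral norm of a matrix; $\sigma_{\max}(A)$ is the largest singular value and $\sigma_{\min}(A)$ the smallest nonzero singular value of $A$. The linear system $Ax=b$ may be consistent or inconsistent. The random matrices have sizes $S_1,S_2\in\mathbb{R}^{m\times p}$ and $T_1,T_2\in\mathbb{R}^{n\times s}$, where $p,s$ may themselves be random; the four matrices in a quadruple need not be independent of each other, but quadruples used at different iterations are independent and identically distributed. All expectations appearing are assumed to exist and be finite. *)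

theory Defs
  imports "HOL-Probability.Probability"
begin

text \<open>An $m \times n$ matrix is an element of \<open>real^'n^'m\<close>.  The library norm of that type is the
  Frobenius norm.\<close>

lemma norm_matrix_is_Frobenius:
  fixes A :: "real^'n^'m"
  shows "norm A = sqrt (\<Sum>i\<in>UNIV. \<Sum>j\<in>UNIV. (A $ i $ j)\<^sup>2)"
  by (simp add: norm_vec_def L2_set_def sum_nonneg)

definition spectral_norm :: "real^'n^'m \<Rightarrow> real" where
  "spectral_norm A = onorm (\<lambda>v. A *v v)"

text \<open>Square roots of the eigenvalues of $A^\top A$.  If $A$ has more columns than rows, this may
  contain an additional \<open>0\<close>, which affects neither of the two notions below.\<close>

definition singular_values :: "real^'n^'m \<Rightarrow> real set" where
  "singular_values A =
     {\<sigma>. \<sigma> \<ge> 0 \<and> (\<exists>v. v \<noteq> 0 \<and> (transpose A ** A) *v v = \<sigma>\<^sup>2 *\<^sub>R v)}"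

definition sigma_max :: "real^'n^'m \<Rightarrow> real" where
  "sigma_max A = Max (singular_values A)"

definition sigma_min :: "real^'n^'m \<Rightarrow> real" where
  "sigma_min A = Min (singular_values A - {0})"

definition is_pseudoinverse :: "real^'n^'m \<Rightarrow> real^'m^'n \<Rightarrow> bool" where
  "is_pseudoinverse A X \<longleftrightarrow>
     A ** X ** A = A \<and> X ** A ** X = X \<and>
     transpose (A ** X) = A ** X \<and> transpose (X ** A) = X ** A"

definition pseudoinverse :: "real^'n^'m \<Rightarrow> real^'m^'n" where
  "pseudoinverse A = (THE X. is_pseudoinverse A X)"

text \<open>A matrix with \<open>CARD('m)\<close> rows and \<open>p\<close> columns, where \<open>p\<close> may be random, is represented by
  \<open>p\<close> together with a sequence of columns, of which only those with index below \<open>p\<close> are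
  significant.  Quadruples $(S_1, S_2, T_1, T_2)$ with $S_1, S_2 \in R^{m \times p}$ and
  $T_1, T_2 \in R^{n \times s}$ are the tuples \<open>(p, S1, S2, s, T1, T2)\<close>; their measurable structure
  is the Borel sigma-algebra of the product topology (discrete on \<open>nat\<close>), i.e. the one generated by
  the sizes and the matrix entries.\<close>

type_synonym ('m, 'n) quadruple =
  "nat \<times> (nat \<Rightarrow> real^'m) \<times> (nat \<Rightarrow> real^'m) \<times> nat \<times> (nat \<Rightarrow> real^'n) \<times> (nat \<Rightarrow> real^'n)"

text \<open>The product $U V^\top$ of matrices \<open>U\<close>, \<open>V\<close> having \<open>p\<close> columns each.\<close>

definition mult_transpose :: "nat \<Rightarrow> (nat \<Rightarrow> real^'a) \<Rightarrow> (nat \<Rightarrow> real^'b) \<Rightarrow> real^'b^'a" where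
  "mult_transpose p U V = (\<chi> i j. \<Sum>l<p. U l $ i * V l $ j)"

text \<open>$T_1 T_2^\top A^\top S_1 S_2^\top$\<close>

definition pfr_matrix :: "real^'n^'m \<Rightarrow> ('m, 'n) quadruple \<Rightarrow> real^'m^'n" where
  "pfr_matrix A Q = (case Q of (p, S1, S2, s, T1, T2) \<Rightarrow>
     mult_transpose s T1 T2 ** transpose A ** mult_transpose p S1 S2)"

text \<open>$S_2 S_1^\top A T_2 T_1^\top T_1 T_2^\top A^\top S_1 S_2^\top$\<close>

definition pfr_gram :: "real^'n^'m \<Rightarrow> ('m, 'n) quadruple \<Rightarrow> real^'m^'m" where
  "pfr_gram A Q = (case Q of (p, S1, S2, s, T1, T2) \<Rightarrow>
     mult_transpose p S2 S1 ** A ** mult_transpose s T2 T1 **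
     mult_transpose s T1 T2 ** transpose A ** mult_transpose p S1 S2)"

end

theory Submission imports Defs begin

text \<open>Write \<open>e\<^sub>k\<close> for the error of the \<open>k\<close>-th iterate and \<open>r\<close> for the residual of the least squares
  solution, which is orthogonal to the range of \<open>A\<close>.  For fixed values of \<open>e\<^sub>k\<close> and \<open>e\<^sub>k\<^sub>-\<^sub>1\<close>, expanding
  the square and averaging over the next quadruple bounds the expected squared error by
  \<open>\<gamma>1 \<parallel>e\<^sub>k\<parallel>\<^sup>2 + \<gamma>2 \<parallel>e\<^sub>k\<^sub>-\<^sub>1\<parallel>\<^sup>2 + 2 \<alpha>\<^sup>2 \<beta>1 \<parallel>r\<parallel>\<^sup>2\<close>; since the next quadruple is independent of the past,
  Fubini turns this into a two-term recurrence for the mean squared errors \<open>F\<^sub>k\<close>.  As \<open>q\<close> is a root of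
  \<open>t\<^sup>2 = \<gamma>1 t + \<gamma>2\<close>, the combination \<open>F\<^sub>k\<^sub>+\<^sub>1 + \<tau> F\<^sub>k\<close> contracts with factor \<open>q\<close>.\<close>

section \<open>Gram matrices, the pseudoinverse and the normal equations\<close>

lemma inner_transpose_mult:
  fixes A :: "real^'n^'m"
  shows "(transpose A *v y) \<bullet> x = y \<bullet> (A *v x)"
  by (metis dot_lmul_matrix vector_transpose_matrix transpose_transpose)

lemma inner_gram:
  fixes A :: "real^'n^'m"
  shows "((transpose A ** A) *v x) \<bullet> y = (A *v x) \<bullet> (A *v y)"
  by (simp only: matrix_vector_mul_assoc [symmetric] inner_transpose_mult)

lemma injective_if_full_column_rank:
  fixes A :: "real^'n^'m"
  assumes "rank A = CARD('n)" "A *v x = 0"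
  shows "x = 0"
  using assms full_rank_injective[of A] by (auto dest: injD[where y = 0])

text \<open>The Penrose equations force \<open>A ** X = A ** Y\<close> and
  \<open>X ** A = Y ** A\<close>; then
  \<open>X = X ** A ** X = X ** A ** Y = Y ** A ** Y = Y\<close>.\<close>

lemma is_pseudoinverse_unique:
  fixes A :: "real^'n^'m"
  assumes X: "is_pseudoinverse A X" and Y: "is_pseudoinverse A Y"
  shows "X = Y"
proof -
  have *: "A ** X ** A = A" "X ** A ** X = X" "transpose (A ** X) = A ** X" "transpose (X ** A) = X ** A"
     "A ** Y ** A = A" "Y ** A ** Y = Y" "transpose (A ** Y) = A ** Y" "transpose (Y ** A) = Y ** A"
    using X Y by (auto simp: is_pseudoinverse_def)
  have "A ** X = transpose (A ** X) ** transpose (A ** Y)"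
    using * by (metis matrix_mul_assoc matrix_transpose_mul)
  also have "\<dots> = A ** Y"
    using * by (metis matrix_mul_assoc)
  finally have 1: "A ** X = A ** Y" .
  have "X ** A = transpose (X ** A) ** transpose (Y ** A)"
    using * by (metis matrix_mul_assoc)
  also have "\<dots> = Y ** A"
    using * by (metis matrix_mul_assoc matrix_transpose_mul)
  finally have 2: "X ** A = Y ** A" .
  show ?thesis
    using 1 2 * by (metis matrix_mul_assoc)
qed

text \<open>The Gram matrix is injective, hence invertible; its inverse times
  \<open>transpose A\<close> is a left inverse of \<open>A\<close> and serves as the
  witness.\<close>

lemma ex_pseudoinverse_full_column_rank:
  fixes A :: "real^'n^'m"
  assumes "rank A = CARD('n)"
  shows "\<exists>X. is_pseudoinverse A X"
proof -
  let ?H = "transpose A ** A"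
  have "x = 0" if "?H *v x = 0" for x
    using that inner_gram[of A x x] injective_if_full_column_rank[OF assms] by simp
  then have "invertible ?H"
    by (metis invertible_left_inverse matrix_left_invertible_ker)
  then obtain K where inv: "?H ** K = mat 1" "K ** ?H = mat 1"
    by (auto simp: invertible_def)
  have "transpose K = transpose K ** (?H ** K)"
    by (simp add: inv)
  also have "\<dots> = transpose (?H ** K) ** K"
    by (simp only: matrix_transpose_mul matrix_mul_assoc transpose_transpose)
  finally have symm: "transpose K = K"
    by (simp add: inv)
  have "is_pseudoinverse A (K ** transpose A)"
    unfolding is_pseudoinverse_def
  proof (intro conjI)
    have *: "K ** transpose A ** A = mat 1"
      using inv by (simp add: matrix_mul_assoc)
    show "A ** (K ** transpose A) ** A = A"
      by (metis * matrix_mul_assoc matrix_mul_rid)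
    show "K ** transpose A ** A ** (K ** transpose A) = K ** transpose A"
      by (simp only: * matrix_mul_lid)
    show "transpose (A ** (K ** transpose A)) = A ** (K ** transpose A)"
      by (simp only: matrix_transpose_mul transpose_transpose symm matrix_mul_assoc)
    show "transpose (K ** transpose A ** A) = K ** transpose A ** A"
      by (simp only: * transpose_mat)
  qed
  then show ?thesis ..
qed

lemma is_pseudoinverse_pseudoinverse:
  fixes A :: "real^'n^'m"
  assumes "rank A = CARD('n)"
  shows "is_pseudoinverse A (pseudoinverse A)"
  unfolding pseudoinverse_def
  using ex_pseudoinverse_full_column_rank[OF assms] is_pseudoinverse_unique
  by (metis theI')

text \<open>Transposing the first Penrose equation and using the symmetry of
  \<open>A ** pseudoinverse A\<close> gives
  \<open>transpose A ** (A ** pseudoinverse A) = transpose A\<close>.\<close>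

lemma normal_equation:
  fixes A :: "real^'n^'m"
  assumes "rank A = CARD('n)"
  shows "transpose A *v (A *v (pseudoinverse A *v b) - b) = 0"
proof -
  have X: "A ** pseudoinverse A ** A = A"
      "transpose (A ** pseudoinverse A) = A ** pseudoinverse A"
    using is_pseudoinverse_pseudoinverse[OF assms] by (auto simp: is_pseudoinverse_def)
  have "transpose A ** (A ** pseudoinverse A) = transpose A"
    by (metis X matrix_transpose_mul)
  then show ?thesis
    by (simp add: matrix_vector_mult_diff_distrib matrix_vector_mul_assoc)
qed

section \<open>Extreme singular values and the quadratic form of the Gram matrix\<close>

text \<open>Moving from \<open>v\<close> against \<open>f v\<close> gives the form the value
  \<open>t * (t * c - 2 * a)\<close>, negative for small \<open>t > 0\<close> unless
  \<open>a = 0\<close>. This turns extremal points of a quadratic form into eigenvectors.\<close>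

lemma psd_form_zero_imp_zero:
  fixes f :: "'a::real_inner \<Rightarrow> 'a"
  assumes lin: "linear f" and sym: "\<And>x y. f x \<bullet> y = x \<bullet> f y"
    and psd: "\<And>x. 0 \<le> f x \<bullet> x" and v: "f v \<bullet> v = 0"
  shows "f v = 0"
proof (rule ccontr)
  interpret linear f by (rule lin)
  assume "f v \<noteq> 0"
  define a where "a = f v \<bullet> f v"
  define c where "c = f (f v) \<bullet> f v"
  have a: "a > 0" using \<open>f v \<noteq> 0\<close> by (simp add: a_def)
  have c: "c \<ge> 0" by (simp add: c_def psd)
  have "0 \<le> f (v - t *\<^sub>R f v) \<bullet> (v - t *\<^sub>R f v)" for t
    by (rule psd)
  also have "f (v - t *\<^sub>R f v) \<bullet> (v - t *\<^sub>R f v) = t * (t * c - 2 * a)" for t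
    using v sym[of v "f v"]
    by (simp add: diff scale inner_diff a_def c_def algebra_simps inner_commute)
  \<comment> \<open>The choice \<open>t = a / (c + 1)\<close> ensures \<open>t * c \<le> a\<close>;
    the added \<open>1\<close> keeps the denominator positive when \<open>c = 0\<close>.\<close>
  finally have "0 \<le> (a / (c + 1)) * ((a / (c + 1)) * c - 2 * a)" .
  moreover have "(a / (c + 1)) * c \<le> a"
    using a c by (simp add: field_simps)
  ultimately show False
    using a c by (smt (verit, best) divide_pos_pos mult_pos_neg)
qed

text \<open>Eigenvectors for distinct singular values are orthogonal, hence independent. Finiteness
  is what gives \<open>Max\<close> and \<open>Min\<close> in the definitions their meaning.\<close>

lemma finite_singular_values:
  fixes A :: "real^'n^'m"
  shows "finite (singular_values A)"
proof -
  define e where "e s = (SOME v. v \<noteq> 0 \<and> (transpose A ** A) *v v = s\<^sup>2 *\<^sub>R v)" for s :: real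
  have e: "e s \<noteq> 0" "(transpose A ** A) *v e s = s\<^sup>2 *\<^sub>R e s" if "s \<in> singular_values A" for s
    using that someI_ex[of "\<lambda>v. v \<noteq> 0 \<and> (transpose A ** A) *v v = s\<^sup>2 *\<^sub>R v"]
    by (auto simp: singular_values_def e_def)
  have orth: "e s \<bullet> e t = 0" if "s \<in> singular_values A" "t \<in> singular_values A" "s \<noteq> t" for s t
  proof -
    have "s\<^sup>2 * (e s \<bullet> e t) = ((transpose A ** A) *v e s) \<bullet> e t"
      using that e by simp
    also have "\<dots> = ((transpose A ** A) *v e t) \<bullet> e s"
      by (metis inner_gram inner_commute)
    also have "\<dots> = t\<^sup>2 * (e s \<bullet> e t)"
      using that e by (simp add: inner_commute)
    finally have "s\<^sup>2 = t\<^sup>2 \<or> e s \<bullet> e t = 0" by auto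
    moreover have "s \<ge> 0" "t \<ge> 0"
      using that by (auto simp: singular_values_def)
    ultimately show ?thesis
      using \<open>s \<noteq> t\<close> by simp
  qed
  have inj: "inj_on e (singular_values A)"
    by (rule inj_onI) (metis e(1) orth inner_eq_zero_iff)
  have "pairwise orthogonal (e ` singular_values A)"
    using orth by (auto simp: pairwise_def orthogonal_def)
  moreover have "0 \<notin> e ` singular_values A"
    using e(1) by auto
  ultimately have "independent (e ` singular_values A)"
    by (rule pairwise_orthogonal_independent)
  then have "finite (e ` singular_values A)"
    by (rule independent_imp_finite)
  then show ?thesis
    using inj by (rule finite_imageD)
qed

lemma singular_valueI:
  fixes A :: "real^'n^'m"
  assumes "(transpose A ** A) *v v = l *\<^sub>R v" "v \<noteq> 0" "l \<ge> 0"
  shows "sqrt l \<in> singular_values A"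
  using assms by (auto simp: singular_values_def)

lemma norm_mult_eq_scaled:
  fixes A :: "real^'n^'m"
  assumes "v \<noteq> 0"
  shows "(norm (A *v v))\<^sup>2 = (norm (A *v (v /\<^sub>R norm v)))\<^sup>2 * (norm v)\<^sup>2"
  using assms by (simp add: matrix_vector_mult_scaleR power_mult_distrib field_simps)

text \<open>The maximum \<open>l\<close> of \<open>(norm (A *v v))\<^sup>2\<close> on the unit
  sphere is an eigenvalue: \<open>l *\<^sub>R y - (transpose A ** A) *v y\<close> has a nonnegative
  form that vanishes at the maximiser. Hence \<open>sqrt l\<close> is a singular value.\<close>

lemma sigma_max_bound:
  fixes A :: "real^'n^'m"
  shows "(norm (A *v x))\<^sup>2 \<le> (sigma_max A)\<^sup>2 * (norm x)\<^sup>2"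
proof -
  have "sphere 0 1 \<noteq> ({} :: (real^'n) set)" by simp
  moreover have "continuous_on (sphere 0 1) (\<lambda>v. (norm (A *v v))\<^sup>2)"
    by (intro continuous_intros)
  ultimately obtain v where v: "norm v = 1"
      and max: "\<And>y. norm y = 1 \<Longrightarrow> (norm (A *v y))\<^sup>2 \<le> (norm (A *v v))\<^sup>2"
    using continuous_attains_sup[OF compact_sphere, of "0 :: real^'n" 1 "\<lambda>v. (norm (A *v v))\<^sup>2"] 
    by auto
  define l where "l = (norm (A *v v))\<^sup>2"
  have le: "(norm (A *v y))\<^sup>2 \<le> l * (norm y)\<^sup>2" for y
  proof (cases "y = 0")
    case False
    then have "(norm (A *v (y /\<^sub>R norm y)))\<^sup>2 \<le> l"
      unfolding l_def by (intro max) simp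
    then show ?thesis
      by (subst norm_mult_eq_scaled[OF False]) (simp add: mult_right_mono)
  qed simp
  have "l *\<^sub>R v - (transpose A ** A) *v v = 0"
  proof (rule psd_form_zero_imp_zero[where f = "\<lambda>y. l *\<^sub>R y - (transpose A ** A) *v y"])
    show "linear (\<lambda>y. l *\<^sub>R y - (transpose A ** A) *v y)"
      by (intro linear_compose_sub matrix_vector_mul_linear linear_scale_self)
  next
    fix x y show "(l *\<^sub>R x - transpose A ** A *v x) \<bullet> y = x \<bullet> (l *\<^sub>R y - transpose A ** A *v y)"
      using inner_gram[of A x y] inner_gram[of A y x] by (simp add: inner_diff inner_commute)
  next
    fix y show "0 \<le> (l *\<^sub>R y - transpose A ** A *v y) \<bullet> y"
      using le[of y] by (simp add: inner_diff inner_gram power2_norm_eq_inner)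
  next
    show "(l *\<^sub>R v - transpose A ** A *v v) \<bullet> v = 0"
      using v by (simp add: inner_diff inner_gram l_def power2_norm_eq_inner flip: power2_norm_eq_inner[of v])
  qed
  then have "sqrt l \<in> singular_values A"
    using v by (intro singular_valueI[where v = v]) (auto simp: l_def)
  then have "sqrt l \<le> sigma_max A"
    unfolding sigma_max_def by (intro Max_ge finite_singular_values)
  then have "l \<le> (sigma_max A)\<^sup>2"
    by (rule sqrt_le_D)
  then show ?thesis
    using le[of x] by (smt (verit) mult_right_mono zero_le_power2)
qed

text \<open>The minimum on the unit sphere is likewise an eigenvalue. Full column rank makes it
  positive, so its root survives the removal of \<open>0\<close> from the singular values.\<close>

lemma sigma_min_bound:
  fixes A :: "real^'n^'m"
  assumes "rank A = CARD('n)"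
  shows "(sigma_min A)\<^sup>2 * (norm x)\<^sup>2 \<le> (norm (A *v x))\<^sup>2"
proof -
  have "sphere 0 1 \<noteq> ({} :: (real^'n) set)" by simp
  moreover have "continuous_on (sphere 0 1) (\<lambda>v. (norm (A *v v))\<^sup>2)"
    by (intro continuous_intros)
  ultimately obtain v where v: "norm v = 1"
      and min: "\<And>y. norm y = 1 \<Longrightarrow> (norm (A *v v))\<^sup>2 \<le> (norm (A *v y))\<^sup>2"
    using continuous_attains_inf[OF compact_sphere, of "0 :: real^'n" 1 "\<lambda>v. (norm (A *v v))\<^sup>2"] 
    by auto
  define l where "l = (norm (A *v v))\<^sup>2"
  have "l \<noteq> 0"
    using v injective_if_full_column_rank[OF assms, of v] by (auto simp: l_def)
  have le: "l * (norm y)\<^sup>2 \<le> (norm (A *v y))\<^sup>2" for y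
  proof (cases "y = 0")
    case False
    then have "l \<le> (norm (A *v (y /\<^sub>R norm y)))\<^sup>2"
      unfolding l_def by (intro min) simp
    then show ?thesis
      by (subst norm_mult_eq_scaled[OF False]) (simp add: mult_right_mono)
  qed simp
  have "(transpose A ** A) *v v - l *\<^sub>R v = 0"
  proof (rule psd_form_zero_imp_zero[where f = "\<lambda>y. (transpose A ** A) *v y - l *\<^sub>R y"])
    show "linear (\<lambda>y. (transpose A ** A) *v y - l *\<^sub>R y)"
      by (intro linear_compose_sub matrix_vector_mul_linear linear_scale_self)
  next
    fix x y show "(transpose A ** A *v x - l *\<^sub>R x) \<bullet> y = x \<bullet> (transpose A ** A *v y - l *\<^sub>R y)"
      using inner_gram[of A x y] inner_gram[of A y x] by (simp add: inner_diff inner_commute)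
  next
    fix y show "0 \<le> (transpose A ** A *v y - l *\<^sub>R y) \<bullet> y"
      using le[of y] by (simp add: inner_diff inner_gram power2_norm_eq_inner)
  next
    show "(transpose A ** A *v v - l *\<^sub>R v) \<bullet> v = 0"
      using v by (simp add: inner_diff inner_gram l_def power2_norm_eq_inner flip: power2_norm_eq_inner[of v])
  qed
  then have sv: "sqrt l \<in> singular_values A - {0}"
    using v \<open>l \<noteq> 0\<close> singular_valueI[where v = v and l = l and A = A] by (force simp: l_def)
  then have "sigma_min A \<le> sqrt l"
    unfolding sigma_min_def by (intro Min_le finite_Diff finite_singular_values)
  moreover have "sigma_min A \<ge> 0"
  proof -
    have "sigma_min A \<in> singular_values A - {0}"
      unfolding sigma_min_def using sv by (intro Min_in finite_Diff finite_singular_values) auto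
    then show ?thesis by (simp add: singular_values_def)
  qed
  ultimately have "(sigma_min A)\<^sup>2 \<le> l"
    by (metis power_mono real_sqrt_pow2 l_def zero_le_power2)
  then show ?thesis
    using le[of x] by (smt (verit) mult_right_mono zero_le_power2)
qed

section \<open>The scalar recurrence and its characteristic root\<close>

text \<open>The coefficients belong to the polynomial with roots \<open>q\<close> and
  \<open>- t\<close>, so \<open>F (Suc k) + t * F k\<close> obeys a first-order recurrence with
  factor \<open>q\<close>. Equal initial values produce \<open>1 + t\<close>, and the constants
  \<open>c\<close> sum to a geometric series.\<close>

lemma two_term_recurrence_bound:
  fixes F :: "nat \<Rightarrow> real"
  assumes rec: "\<And>k. F (Suc (Suc k)) \<le> (q - t) * F (Suc k) + q * t * F k + c"
    and nonneg: "\<And>k. 0 \<le> F k" and q: "0 \<le> q" "q \<noteq> 1" and t: "0 \<le> t"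
    and init: "F 1 = F 0"
  shows "F (Suc k) \<le> q ^ k * (1 + t) * F 0 + c * (1 - q ^ k) / (1 - q)"
proof -
  have "F (Suc k) + t * F k \<le> q ^ k * (1 + t) * F 0 + c * (1 - q ^ k) / (1 - q)"
  proof (induction k)
    case 0
    then show ?case using init by (simp add: algebra_simps)
  next
    case (Suc k)
    have "F (Suc (Suc k)) + t * F (Suc k) \<le> q * (F (Suc k) + t * F k) + c"
      using rec[of k] by (simp add: algebra_simps)
    also have "\<dots> \<le> q * (q ^ k * (1 + t) * F 0 + c * (1 - q ^ k) / (1 - q)) + c"
      using mult_left_mono[OF Suc.IH q(1)] by simp
    also have "\<dots> = q ^ Suc k * (1 + t) * F 0 + c * (1 - q ^ Suc k) / (1 - q)"
      using q(2) by (simp add: field_simps)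
    finally show ?case .
  qed
  moreover have "0 \<le> t * F k"
    using t nonneg by simp
  ultimately show ?thesis by linarith
qed

text \<open>Squaring shows that \<open>g1 + g2 < 1\<close> puts the square root below
  \<open>2 - g1\<close>, that is \<open>q < 1\<close>; then
  \<open>g2 = q * (q - g1) \<le> q - g1\<close>.\<close>

lemma momentum_root:
  fixes g1 g2 :: real
  assumes g2: "0 \<le> g2" and sum: "g1 + g2 < 1"
    and q: "q = (g1 + sqrt (g1\<^sup>2 + 4 * g2)) / 2"
  shows "q * (q - g1) = g2" "g1 \<le> q" "0 \<le> q" "g1 + g2 \<le> q" "q < 1"
proof -
  define r where "r = sqrt (g1\<^sup>2 + 4 * g2)"
  have r2: "r\<^sup>2 = g1\<^sup>2 + 4 * g2"
    using g2 by (simp add: r_def)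
  have r: "\<bar>g1\<bar> \<le> r"
    using g2 by (simp add: r_def real_le_rsqrt)
  have qr: "q = (g1 + r) / 2"
    by (simp add: q r_def)
  show root: "q * (q - g1) = g2"
    using r2 by (simp add: qr power2_eq_square field_simps)
  show g1: "g1 \<le> q" and q0: "0 \<le> q"
    using r by (auto simp: qr)
  have "r < 2 - g1"
    unfolding r_def using g2 sum by (intro real_less_lsqrt) (auto simp: power2_eq_square algebra_simps)
  then show q1: "q < 1"
    by (simp add: qr)
  have "(q - g1) * q \<le> (q - g1) * 1"
    using g1 q1 by (intro mult_left_mono) auto
  then show "g1 + g2 \<le> q"
    using root by (simp add: mult.commute)
qed

section \<open>Independence and iterated integrals\<close>

text \<open>The joint law is a product, and Tonelli's theorem splits the integral. Nonnegative
  integrals require no integrability in advance, so the identity can itself serve to prove moments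
  finite.\<close>

lemma (in prob_space) nn_integral_indep_var:
  assumes indep: "indep_var N1 X N2 Y" and h: "h \<in> borel_measurable (N1 \<Otimes>\<^sub>M N2)"
  shows "(\<integral>\<^sup>+ w. h (X w, Y w) \<partial>M) = (\<integral>\<^sup>+ w. (\<integral>\<^sup>+ w'. h (X w, Y w') \<partial>M) \<partial>M)"
proof -
  have X [measurable]: "X \<in> measurable M N1" and Y [measurable]: "Y \<in> measurable M N2"
    using indep by (auto dest: indep_var_rv1 indep_var_rv2)
  interpret Y: prob_space "distr M N2 Y"
    by (rule prob_space_distr) (rule Y)
  note h [measurable]
  have "(\<integral>\<^sup>+ w. h (X w, Y w) \<partial>M) = (\<integral>\<^sup>+ z. h z \<partial>distr M (N1 \<Otimes>\<^sub>M N2) (\<lambda>w. (X w, Y w)))"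
    by (simp add: nn_integral_distr)
  also have "distr M (N1 \<Otimes>\<^sub>M N2) (\<lambda>w. (X w, Y w)) = distr M N1 X \<Otimes>\<^sub>M distr M N2 Y"
    using indep by (simp add: indep_var_distribution_eq)
  also have "(\<integral>\<^sup>+ z. h z \<partial>(distr M N1 X \<Otimes>\<^sub>M distr M N2 Y)) =
      (\<integral>\<^sup>+ x. (\<integral>\<^sup>+ y. h (x, y) \<partial>distr M N2 Y) \<partial>distr M N1 X)"
    by (rule Y.nn_integral_fst [symmetric]) simp
  also have "\<dots> = (\<integral>\<^sup>+ w. (\<integral>\<^sup>+ y. h (X w, y) \<partial>distr M N2 Y) \<partial>M)"
    by (simp add: nn_integral_distr)
  also have "\<dots> = (\<integral>\<^sup>+ w. (\<integral>\<^sup>+ w'. h (X w, Y w') \<partial>M) \<partial>M)"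
  proof (rule nn_integral_cong)
    fix w assume "w \<in> space M"
    then have "X w \<in> space N1"
      by (rule measurable_space[OF X])
    then have "(\<lambda>y. h (X w, y)) \<in> borel_measurable N2"
      by (rule measurable_compose[OF measurable_Pair1' h])
    then show "(\<integral>\<^sup>+ y. h (X w, y) \<partial>distr M N2 Y) = (\<integral>\<^sup>+ w'. h (X w, Y w') \<partial>M)"
      by (simp add: nn_integral_distr[OF Y])
  qed
  finally show ?thesis .
qed

section \<open>The expected error after one step from a fixed state\<close>

lemma bounded_linear_inner_mult:
  "bounded_linear (\<lambda>B :: real^'n^'m. p \<bullet> (B *v y))"
  by (intro linear_conv_bounded_linear[THEN iffD1] linearI)
     (simp_all add: matrix_vector_mult_add_rdistrib inner_add_right scaleR_matrix_vector_assoc [symmetric])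

lemma transpose_mult_transpose: "transpose (mult_transpose p U V) = mult_transpose p V U"
  by (simp add: mult_transpose_def transpose_def mult.commute)

lemma pfr_gram_eq: "pfr_gram A Q = transpose (pfr_matrix A Q) ** pfr_matrix A Q"
  by (cases Q) (simp add: pfr_gram_def pfr_matrix_def matrix_transpose_mul matrix_mul_assoc
      transpose_mult_transpose)

text \<open>The right side minus the left side is
  \<open>\<omega> * (1 + \<omega>) * (norm (v + u))\<^sup>2\<close>.\<close>

lemma momentum_norm_bound:
  fixes u v :: "'a::real_inner" and \<omega> :: real
  assumes "0 \<le> \<omega>"
  shows "(norm ((1 + \<omega>) *\<^sub>R v - \<omega> *\<^sub>R u))\<^sup>2
    \<le> (1 + 3 * \<omega> + 2 * \<omega>\<^sup>2) * (norm v)\<^sup>2 + (2 * \<omega>\<^sup>2 + \<omega>) * (norm u)\<^sup>2"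
proof -
  have "0 \<le> (norm (v + u))\<^sup>2 * (\<omega> * (1 + \<omega>))"
    using assms by simp
  then show ?thesis
    by (simp add: power2_norm_eq_inner power2_eq_square[of \<omega>] inner_add inner_diff
        algebra_simps inner_commute)
qed

lemma two_inner_bound:
  fixes u v :: "'a::real_inner"
  shows "2 * (u \<bullet> v) \<le> (norm u)\<^sup>2 + (norm v)\<^sup>2"
proof -
  have "0 \<le> (norm (u - v))\<^sup>2" by simp
  then show ?thesis
    by (simp add: power2_norm_eq_inner inner_diff inner_commute)
qed

text \<open>\<open>G\<close> models the update matrix of one iteration and \<open>c\<close> becomes
  \<open>1 / (norm A)\<^sup>2\<close>. The vector \<open>r\<close> is anything orthogonal to the
  range of \<open>A\<close>, so both the least squares residual and \<open>0\<close> can be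
  inserted.\<close>

context
  fixes M :: "'w measure" and G :: "'w \<Rightarrow> real^'m^'n" and A :: "real^'n^'m"
    and r :: "real^'m" and \<beta> c :: real
  assumes prob: "prob_space M"
    and int_G: "integrable M G" and int_gram: "integrable M (\<lambda>w. transpose (G w) ** G w)"
    and mean: "(\<integral>w. G w \<partial>M) = c *\<^sub>R transpose A"
    and beta: "\<beta> = spectral_norm (\<integral>w. transpose (G w) ** G w \<partial>M)"
    and r: "transpose A *v r = 0" and c: "0 \<le> c"
begin

interpretation prob_space M by (rule prob)

text \<open>The squared norm is linear in \<open>transpose (G w) ** G w\<close>, so its mean is the
  quadratic form of the mean Gram matrix.\<close>

lemma expected_norm_mult_le:
  shows "integrable M (\<lambda>w. (norm (G w *v y))\<^sup>2)"
    and "(\<integral>w. (norm (G w *v y))\<^sup>2 \<partial>M) \<le> \<beta> * (norm y)\<^sup>2"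
proof -
  have eq: "(norm (G w *v y))\<^sup>2 = y \<bullet> ((transpose (G w) ** G w) *v y)" for w
    by (metis inner_gram inner_commute power2_norm_eq_inner)
  show "integrable M (\<lambda>w. (norm (G w *v y))\<^sup>2)"
    unfolding eq by (rule integrable_bounded_linear[OF bounded_linear_inner_mult int_gram])
  let ?E = "\<integral>w. transpose (G w) ** G w \<partial>M"
  have "(\<integral>w. (norm (G w *v y))\<^sup>2 \<partial>M) = y \<bullet> (?E *v y)"
    unfolding eq by (rule integral_bounded_linear[OF bounded_linear_inner_mult int_gram])
  also have "\<dots> \<le> norm y * norm (?E *v y)"
    by (rule norm_cauchy_schwarz)
  also have "\<dots> \<le> norm y * (\<beta> * norm y)"
    unfolding beta spectral_norm_def by (intro mult_left_mono onorm matrix_vector_mul_bounded_linear norm_ge_zero)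
  finally show "(\<integral>w. (norm (G w *v y))\<^sup>2 \<partial>M) \<le> \<beta> * (norm y)\<^sup>2"
    by (simp add: power2_eq_square mult_ac)
qed

lemma expected_step_le:
  fixes u v :: "real^'n" and \<alpha> \<omega> :: real
  assumes \<alpha>: "0 \<le> \<alpha>" and \<omega>: "0 \<le> \<omega>"
  defines "S \<equiv> \<lambda>w. (norm (v - \<alpha> *\<^sub>R (G w *v (A *v v + r)) + \<omega> *\<^sub>R (v - u)))\<^sup>2"
  shows "integrable M S"
    and "(\<integral>w. S w \<partial>M)
      \<le> (1 + 3 * \<omega> + 2 * \<omega>\<^sup>2) * (norm v)\<^sup>2 + (2 * \<omega>\<^sup>2 + \<omega>) * (norm u)\<^sup>2
        - (c * (2 * \<alpha> + \<alpha> * \<omega>) - \<alpha>\<^sup>2 * \<beta>) * (norm (A *v v))\<^sup>2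
        + c * (\<alpha> * \<omega>) * (norm (A *v u))\<^sup>2 + \<alpha>\<^sup>2 * \<beta> * (norm r)\<^sup>2"
proof -
  define p where "p = (1 + \<omega>) *\<^sub>R v - \<omega> *\<^sub>R u"
  define y where "y = A *v v + r"
  have S: "S w = (norm p)\<^sup>2 - 2 * \<alpha> * (p \<bullet> (G w *v y)) + \<alpha>\<^sup>2 * (norm (G w *v y))\<^sup>2" for w
  proof -
    have "S w = (norm (p - \<alpha> *\<^sub>R (G w *v y)))\<^sup>2"
      by (simp add: S_def p_def y_def algebra_simps)
    also have "\<dots> = (norm p)\<^sup>2 - 2 * \<alpha> * (p \<bullet> (G w *v y)) + \<alpha>\<^sup>2 * (norm (G w *v y))\<^sup>2"
      unfolding power2_norm_eq_inner by (simp add: inner_diff inner_commute power2_eq_square algebra_simps)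
    finally show ?thesis .
  qed
  have int1: "integrable M (\<lambda>w. p \<bullet> (G w *v y))"
    by (rule integrable_bounded_linear[OF bounded_linear_inner_mult int_G])
  note int2 = expected_norm_mult_le(1)[of y]
  show "integrable M S"
    unfolding S using int1 int2 by simp
  \<comment> \<open>Orthogonality removes \<open>r\<close> from the cross term and lets
    \<open>(norm y)\<^sup>2\<close> split without a mixed term.\<close>
  have orth: "(A *v z) \<bullet> r = 0" for z
    by (metis r inner_transpose_mult inner_commute inner_zero_left)
  have "(\<integral>w. p \<bullet> (G w *v y) \<partial>M) = p \<bullet> ((c *\<^sub>R transpose A) *v y)"
    using integral_bounded_linear[OF bounded_linear_inner_mult int_G, of p y] by (simp add: mean)
  also have "\<dots> = c * ((transpose A *v y) \<bullet> p)"
    by (metis scaleR_matrix_vector_assoc inner_scaleR_right inner_commute)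
  also have "\<dots> = c * ((A *v v + r) \<bullet> ((1 + \<omega>) *\<^sub>R (A *v v) - \<omega> *\<^sub>R (A *v u)))"
    by (simp only: inner_transpose_mult y_def p_def matrix_vector_mult_diff_distrib matrix_vector_mult_scaleR)
  also have "\<dots> = c * ((1 + \<omega>) * (norm (A *v v))\<^sup>2 - \<omega> * ((A *v u) \<bullet> (A *v v)))"
    unfolding power2_norm_eq_inner
    using orth[of u] orth[of v] by (simp add: inner_diff inner_add inner_commute)
  finally have cross: "(\<integral>w. p \<bullet> (G w *v y) \<partial>M)
      = c * ((1 + \<omega>) * (norm (A *v v))\<^sup>2 - \<omega> * ((A *v u) \<bullet> (A *v v)))" .
  have y2: "(norm y)\<^sup>2 = (norm (A *v v))\<^sup>2 + (norm r)\<^sup>2"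
    unfolding y_def power2_norm_eq_inner using orth[of v] by (simp add: inner_add inner_commute)
  have "(\<integral>w. S w \<partial>M) = (norm p)\<^sup>2 - 2 * \<alpha> * (\<integral>w. p \<bullet> (G w *v y) \<partial>M)
      + \<alpha>\<^sup>2 * (\<integral>w. (norm (G w *v y))\<^sup>2 \<partial>M)"
    unfolding S using int1 int2 by (simp add: prob_space)
  moreover have "\<alpha>\<^sup>2 * (\<integral>w. (norm (G w *v y))\<^sup>2 \<partial>M) \<le> \<alpha>\<^sup>2 * (\<beta> * (norm y)\<^sup>2)"
    by (intro mult_left_mono expected_norm_mult_le) simp
  \<comment> \<open>Splitting the mixed product returns \<open>c * (\<alpha> * \<omega>)\<close> to
    \<open>(norm (A *v v))\<^sup>2\<close>, so \<open>2 * \<alpha> * (1 + \<omega>)\<close> becomes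
    \<open>2 * \<alpha> + \<alpha> * \<omega>\<close>.\<close>
  moreover have "c * (\<alpha> * \<omega>) * (2 * ((A *v u) \<bullet> (A *v v)))
      \<le> c * (\<alpha> * \<omega>) * ((norm (A *v u))\<^sup>2 + (norm (A *v v))\<^sup>2)"
    using c \<alpha> \<omega> by (intro mult_left_mono two_inner_bound) simp
  moreover note momentum_norm_bound[OF \<omega>, of v u, folded p_def]
  ultimately show "(\<integral>w. S w \<partial>M)
      \<le> (1 + 3 * \<omega> + 2 * \<omega>\<^sup>2) * (norm v)\<^sup>2 + (2 * \<omega>\<^sup>2 + \<omega>) * (norm u)\<^sup>2
        - (c * (2 * \<alpha> + \<alpha> * \<omega>) - \<alpha>\<^sup>2 * \<beta>) * (norm (A *v v))\<^sup>2
        + c * (\<alpha> * \<omega>) * (norm (A *v u))\<^sup>2 + \<alpha>\<^sup>2 * \<beta> * (norm r)\<^sup>2"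
    unfolding cross y2 by (simp add: algebra_simps)
qed

end

section \<open>Random recursions driven by independent samples\<close>

text \<open>The library's \<^const>\<open>prob_space.indep_var\<close> only relates variables of the same type, so independence of
  \<open>Z k\<close> and \<open>Y (Suc k)\<close> is expressed through the factorisation of integrals.\<close>

lemma (in prob_space) nn_integral_random_recursion:
  assumes indep: "indep_vars (\<lambda>_. N) Y {1..}"
    and step: "step \<in> measurable (L \<Otimes>\<^sub>M N) L" and z0: "z0 \<in> space L"
    and Z_0: "\<And>w. Z 0 w = z0" and Z_Suc: "\<And>k w. Z (Suc k) w = step (Z k w, Y (Suc k) w)"
  shows "Z k \<in> measurable M L"
    and "h \<in> borel_measurable (L \<Otimes>\<^sub>M N) \<Longrightarrow> (\<integral>\<^sup>+ w. h (Z k w, Y (Suc k) w) \<partial>M)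
      = (\<integral>\<^sup>+ w. (\<integral>\<^sup>+ w'. h (Z k w, Y (Suc k) w') \<partial>M) \<partial>M)"
proof -
  \<comment> \<open>\<open>f k\<close> is the recursion as a function of the samples
    \<open>h\<close>, which exhibits \<open>Z k\<close> as a function of \<open>Y 1\<close> to
    \<open>Y k\<close> alone.\<close>
  define f where "f = rec_nat (\<lambda>_. z0) (\<lambda>k g h. step (g h, h (Suc k)))"
  have f_meas: "f k \<in> measurable (Pi\<^sub>M {1..n} (\<lambda>_. N)) L" if "k \<le> n" for k n
    using that
  proof (induction k)
    case 0
    then show ?case using z0 by (simp add: f_def)
  next
    case (Suc k)
    note step [measurable]
    have [measurable]: "f k \<in> measurable (Pi\<^sub>M {1..n} (\<lambda>_. N)) L"
      using Suc by simp
    have [measurable]: "(\<lambda>h. h (Suc k)) \<in> measurable (Pi\<^sub>M {1..n} (\<lambda>_. N)) N"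
      using Suc.prems by (intro measurable_component_singleton) simp
    have "(\<lambda>h. step (f k h, h (Suc k))) \<in> measurable (Pi\<^sub>M {1..n} (\<lambda>_. N)) L"
      by measurable
    then show ?case by (simp add: f_def)
  qed
  have f_eq: "f k (\<lambda>i\<in>{1..n}. Y i w) = Z k w" if "k \<le> n" for k n w
    using that by (induction k) (simp_all add: f_def Z_0 Z_Suc)
  \<comment> \<open>The block \<open>{Suc k}\<close> is kept as a one-point product so that both
    restricted families have the same type.\<close>
  have ind: "indep_var (Pi\<^sub>M {1..k} (\<lambda>_. N)) (\<lambda>w. \<lambda>i\<in>{1..k}. Y i w)
      (Pi\<^sub>M {Suc k} (\<lambda>_. N)) (\<lambda>w. \<lambda>i\<in>{Suc k}. Y i w)"
    by (rule indep_var_restrict[OF indep]) auto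
  note fk [measurable] = f_meas[OF order_refl, of k]
  show "Z k \<in> measurable M L"
    using measurable_compose[OF indep_var_rv1[OF ind] fk] by (simp add: f_eq del: One_nat_def)
  assume h [measurable]: "h \<in> borel_measurable (L \<Otimes>\<^sub>M N)"
  have [measurable]: "(\<lambda>g. g (Suc k)) \<in> measurable (Pi\<^sub>M {Suc k} (\<lambda>_. N)) N"
    by (rule measurable_component_singleton) simp
  have "(\<lambda>(p, g). h (f k p, g (Suc k)))
      \<in> borel_measurable (Pi\<^sub>M {1..k} (\<lambda>_. N) \<Otimes>\<^sub>M Pi\<^sub>M {Suc k} (\<lambda>_. N))"
    by measurable
  from nn_integral_indep_var[OF ind this]
  show "(\<integral>\<^sup>+ w. h (Z k w, Y (Suc k) w) \<partial>M)
      = (\<integral>\<^sup>+ w. (\<integral>\<^sup>+ w'. h (Z k w, Y (Suc k) w') \<partial>M) \<partial>M)"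
    by (simp add: f_eq del: One_nat_def)
qed

section \<open>Mean square convergence of the momentum iteration\<close>

lemma spectral_norm_nonneg: "0 \<le> spectral_norm A"
  unfolding spectral_norm_def by (intro onorm_pos_le matrix_vector_mul_bounded_linear)

lemma continuous_on_matrix_vector_mult:
  fixes f :: "'a::topological_space \<Rightarrow> real^'n^'m"
  assumes "continuous_on S f" "continuous_on S g"
  shows "continuous_on S (\<lambda>x. f x *v g x)"
  unfolding matrix_vector_mult_def
  using assms by (intro continuous_intros)

theorem theorem4p4:
  fixes A :: "real^'n^'m" and b :: "real^'m"
    and D :: "('m, 'n) quadruple measure"
    and M :: "'w measure" and Q :: "nat \<Rightarrow> 'w \<Rightarrow> ('m, 'n) quadruple"
    and x0 :: "real^'n" and x :: "nat \<Rightarrow> 'w \<Rightarrow> real^'n"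
    and \<alpha> \<omega> \<beta>1 \<gamma>1 \<gamma>2 q \<tau> :: real
  assumes full_column_rank: "rank A = CARD('n)"
    and D_prob: "prob_space D"
    and D_sets: "sets D = sets borel"
    and D_int1: "integrable D (pfr_matrix A)"
    and D_int2: "integrable D (pfr_gram A)"
    and D_mean: "(\<integral>Z. pfr_matrix A Z \<partial>D) = (1 / (norm A)\<^sup>2) *\<^sub>R transpose A"
    and M_prob: "prob_space M"
    and Q_indep: "prob_space.indep_vars M (\<lambda>_. borel) Q {1..}"
    and Q_distr: "\<And>k. k \<ge> 1 \<Longrightarrow> distr M borel (Q k) = D"
    and x_0: "\<And>w. w \<in> space M \<Longrightarrow> x 0 w = x0"
    and x_1: "\<And>w. w \<in> space M \<Longrightarrow> x 1 w = x0"
    and x_step: "\<And>k w. k \<ge> 1 \<Longrightarrow> w \<in> space M \<Longrightarrow>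
      x (k + 1) w = x k w - \<alpha> *\<^sub>R (pfr_matrix A (Q k w) *v (A *v x k w - b))
        + \<omega> *\<^sub>R (x k w - x (k - 1) w)"
    and beta1: "\<beta>1 = spectral_norm (\<integral>Z. pfr_gram A Z \<partial>D)"
    and alpha: "0 < \<alpha>" "\<alpha> < 1 / (\<beta>1 * (norm A)\<^sup>2)"
    and omega: "\<omega> \<ge> 0"
    and gamma1: "\<gamma>1 = 1 + 3 * \<omega> + 2 * \<omega>\<^sup>2
      - (2 * \<alpha> + \<alpha> * \<omega> - 2 * \<alpha>\<^sup>2 * \<beta>1 * (norm A)\<^sup>2) * ((sigma_min A)\<^sup>2 / (norm A)\<^sup>2)"
    and gamma2: "\<gamma>2 = 2 * \<omega>\<^sup>2 + \<omega> + \<omega> * \<alpha> * ((sigma_max A)\<^sup>2 / (norm A)\<^sup>2)"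
    and gamma_sum: "\<gamma>1 + \<gamma>2 < 1"
    and q: "q = (if \<omega> > 0 then (\<gamma>1 + sqrt (\<gamma>1\<^sup>2 + 4 * \<gamma>2)) / 2 else \<gamma>1)"
    and tau: "\<tau> = q - \<gamma>1"
  shows "(\<forall>k. integrable M (\<lambda>w. (norm (x (k + 1) w - pseudoinverse A *v b))\<^sup>2) \<and>
            (\<integral>w. (norm (x (k + 1) w - pseudoinverse A *v b))\<^sup>2 \<partial>M)
            \<le> q ^ k * (1 + \<tau>) * (norm (x0 - pseudoinverse A *v b))\<^sup>2
              + 2 * \<alpha>\<^sup>2 * \<beta>1 * (1 - q ^ k)
                * (norm (A *v (pseudoinverse A *v b) - b))\<^sup>2 / (1 - q))
         \<and> \<tau> \<ge> 0 \<and> \<gamma>1 + \<gamma>2 \<le> q \<and> q < 1"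
proof -
  interpret prob_space M by (rule M_prob)
  define xs where "xs = pseudoinverse A *v b"
  define r where "r = A *v xs - b"
  define c where "c = 1 / (norm A)\<^sup>2"
  define G where "G k w = pfr_matrix A (Q k w)" for k w
  define R where "R r u v = \<gamma>1 * (norm v)\<^sup>2 + \<gamma>2 * (norm u)\<^sup>2 + 2 * \<alpha>\<^sup>2 * \<beta>1 * (norm r)\<^sup>2"
    for r :: "real^'m" and u v :: "real^'n"

  have r: "transpose A *v r = 0"
    unfolding r_def xs_def by (rule normal_equation[OF full_column_rank])
  have beta_nonneg: "0 \<le> \<beta>1"
    by (simp add: beta1 spectral_norm_nonneg)
  \<comment> \<open>Division by zero: a vanishing denominator would turn the upper bound on \<open>\<alpha>\<close> into \<open>0\<close>.\<close>
  have "\<beta>1 * (norm A)\<^sup>2 \<noteq> 0"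
    using alpha by auto
  then have A0: "norm A \<noteq> 0" and pos: "0 < \<beta>1 * (norm A)\<^sup>2"
    using beta_nonneg by (auto simp: less_le)
  \<comment> \<open>The upper bound on \<alpha> enters here. It makes the coefficient in
    \<open>kappa\<close> nonnegative, so that the lower bound through \<open>sigma_min A\<close> can
    be multiplied by it.\<close>
  have "\<alpha> * (\<beta>1 * (norm A)\<^sup>2) < 1"
    using alpha(2) pos by (simp add: field_simps)
  then have "\<alpha> * \<beta>1 \<le> c"
    using A0 by (simp add: c_def field_simps)
  then have "2 * \<alpha> * (\<alpha> * \<beta>1) \<le> 2 * \<alpha> * c"
    using alpha(1) by (intro mult_left_mono) auto
  moreover have "0 \<le> c * (\<alpha> * \<omega>)"
    using alpha(1) omega by (simp add: c_def)
  ultimately have kappa: "0 \<le> c * (2 * \<alpha> + \<alpha> * \<omega>) - 2 * \<alpha>\<^sup>2 * \<beta>1"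
    by (simp add: power2_eq_square algebra_simps)
  have g1: "\<gamma>1 = 1 + 3 * \<omega> + 2 * \<omega>\<^sup>2
      - (c * (2 * \<alpha> + \<alpha> * \<omega>) - 2 * \<alpha>\<^sup>2 * \<beta>1) * (sigma_min A)\<^sup>2"
    using A0 by (simp add: gamma1 c_def field_simps)
  have g2: "\<gamma>2 = 2 * \<omega>\<^sup>2 + \<omega> + c * (\<alpha> * \<omega>) * (sigma_max A)\<^sup>2"
    by (simp add: gamma2 c_def)
  have g2_nonneg: "0 \<le> \<gamma>2"
    using omega alpha(1) by (simp add: gamma2)

  have Q_meas: "Q k \<in> measurable M borel" if "k \<ge> 1" for k
    using Q_indep that by (auto simp: indep_vars_def)
  have pfr_meas: "pfr_matrix A \<in> borel_measurable borel"
    using borel_measurable_integrable[OF D_int1] D_sets by (simp cong: measurable_cong_sets)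
  have gram_meas: "pfr_gram A \<in> borel_measurable borel"
    using borel_measurable_integrable[OF D_int2] D_sets by (simp cong: measurable_cong_sets)
  have step: "integrable M (\<lambda>w. (norm (v - \<alpha> *\<^sub>R (G k w *v (A *v v + r)) + \<omega> *\<^sub>R (v - u)))\<^sup>2)"
      "(\<integral>w. (norm (v - \<alpha> *\<^sub>R (G k w *v (A *v v + r)) + \<omega> *\<^sub>R (v - u)))\<^sup>2 \<partial>M) \<le> R r u v"
    if k: "k \<ge> 1" and r: "transpose A *v r = 0" for k r u v
  proof -
    note D = Q_distr[OF k] and Qk = Q_meas[OF k]
    have G: "integrable M (G k)"
      using D_int1 integrable_distr_eq[OF Qk pfr_meas] by (simp add: D G_def[abs_def])
    have gram: "pfr_gram A (Q k w) = transpose (G k w) ** G k w" for w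
      by (simp add: pfr_gram_eq G_def)
    have Gram: "integrable M (\<lambda>w. transpose (G k w) ** G k w)"
      using D_int2 integrable_distr_eq[OF Qk gram_meas] by (simp add: D gram)
    have mean: "(\<integral>w. G k w \<partial>M) = c *\<^sub>R transpose A"
      using D_mean integral_distr[OF Qk pfr_meas] by (simp add: D G_def c_def)
    have beta: "\<beta>1 = spectral_norm (\<integral>w. transpose (G k w) ** G k w \<partial>M)"
      using integral_distr[OF Qk gram_meas] by (simp add: beta1 D gram)
    note step = expected_step_le[OF M_prob G Gram mean beta r, of \<alpha> \<omega> v u]
    show "integrable M (\<lambda>w. (norm (v - \<alpha> *\<^sub>R (G k w *v (A *v v + r)) + \<omega> *\<^sub>R (v - u)))\<^sup>2)"
      using step(1) alpha(1) omega by (simp add: c_def)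
    have "(c * (2 * \<alpha> + \<alpha> * \<omega>) - 2 * \<alpha>\<^sup>2 * \<beta>1) * ((sigma_min A)\<^sup>2 * (norm v)\<^sup>2)
        \<le> (c * (2 * \<alpha> + \<alpha> * \<omega>) - 2 * \<alpha>\<^sup>2 * \<beta>1) * (norm (A *v v))\<^sup>2"
      by (intro mult_left_mono sigma_min_bound full_column_rank kappa)
    moreover have "c * (\<alpha> * \<omega>) * (norm (A *v u))\<^sup>2
        \<le> c * (\<alpha> * \<omega>) * ((sigma_max A)\<^sup>2 * (norm u)\<^sup>2)"
      using alpha(1) omega by (intro mult_left_mono sigma_max_bound) (simp add: c_def)
    \<comment> \<open>The one-step estimate carries \<open>\<alpha>\<^sup>2 * \<beta>1\<close>,
      while \<open>R\<close> carries twice that amount; these terms make up the difference.\<close>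
    moreover have "0 \<le> \<alpha>\<^sup>2 * \<beta>1 * (norm (A *v v))\<^sup>2" "0 \<le> \<alpha>\<^sup>2 * \<beta>1 * (norm r)\<^sup>2"
      using beta_nonneg by simp_all
    moreover note step(2)
    ultimately show "(\<integral>w. (norm (v - \<alpha> *\<^sub>R (G k w *v (A *v v + r)) + \<omega> *\<^sub>R (v - u)))\<^sup>2 \<partial>M) \<le> R r u v"
      using alpha(1) omega by (simp add: R_def g1 g2 c_def algebra_simps)
  qed
  \<comment> \<open>The sign is read off from the mean square that \<open>R\<close> dominates, since
    the formula for \<gamma>1 does not show one.\<close>
  have R_nonneg: "0 \<le> R r u v" if "transpose A *v r = 0" for r u v
    using step(2)[of 1 r v u] that by (rule_tac order_trans[OF integral_nonneg_AE]) auto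

  have "0 \<le> q \<and> q * \<tau> = \<gamma>2 \<and> 0 \<le> \<tau> \<and> \<gamma>1 + \<gamma>2 \<le> q \<and> q < 1"
  proof (cases "\<omega> > 0")
    case True
    then show ?thesis
      using momentum_root[OF g2_nonneg gamma_sum, of q] by (simp add: q tau)
  next
    case False
    then have "\<omega> = 0" using omega by simp
    \<comment> \<open>For a zero residual the one-step bound reads \<open>\<gamma>1 * (norm v)\<^sup>2\<close>, and it dominates a square.\<close>
    moreover have "0 \<le> \<gamma>1"
      using R_nonneg[of 0 0 "axis undefined 1"] by (simp add: R_def)
    ultimately show ?thesis
      using gamma_sum by (simp add: q tau gamma2)
  qed
  then have q0: "0 \<le> q" and q_tau: "q * \<tau> = \<gamma>2" and tau0: "0 \<le> \<tau>"
      and sum_le: "\<gamma>1 + \<gamma>2 \<le> q" and q1: "q < 1"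
    by auto

  \<comment> \<open>The state is a pair of consecutive errors, which turns the two-step iteration
    into a one-step recursion.\<close>
  define next_state where "next_state = (\<lambda>((u, v), B).
      (v, v - \<alpha> *\<^sub>R (B *v (A *v v + r)) + \<omega> *\<^sub>R (v - u)))"
  \<comment> \<open>\<open>Z\<close> obeys the recursion at every \<open>w\<close>, whereas
    \<open>x\<close> is constrained only on \<open>space M\<close>. The pair \<open>Z k\<close>
    holds the errors of index \<open>k\<close> and \<open>Suc k\<close>, so the next matrix is
    \<open>G (Suc k)\<close>.\<close>
  define Z where "Z k w = rec_nat (x0 - xs, x0 - xs) (\<lambda>k z. next_state (z, G (Suc k) w)) k"
    for k and w :: 'w
  have Z_Suc: "Z (Suc k) w = next_state (Z k w, G (Suc k) w)" for k w
    by (simp add: Z_def)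
  have Z_eq: "Z k w = (x k w - xs, x (Suc k) w - xs)" if w: "w \<in> space M" for k w
  proof (induction k)
    case 0
    then show ?case using x_0[OF w] x_1[OF w] by (simp add: Z_def)
  next
    case (Suc k)
    have "A *v x (Suc k) w - b = A *v (x (Suc k) w - xs) + r"
      by (simp add: r_def matrix_vector_mult_diff_distrib)
    then show ?case
      using x_step[of "Suc k" w] w by (simp add: Z_Suc Suc.IH next_state_def G_def)
  qed
  have next_meas: "next_state \<in> borel_measurable ((borel \<Otimes>\<^sub>M borel) \<Otimes>\<^sub>M borel)"
    unfolding next_state_def borel_prod split_def
    by (intro borel_measurable_continuous_onI continuous_intros continuous_on_matrix_vector_mult)
  have G_indep: "indep_vars (\<lambda>_. borel) G {1..}"
    using indep_vars_compose[OF Q_indep, of "\<lambda>_. pfr_matrix A" "\<lambda>_. borel"] pfr_meas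
    by (simp add: comp_def G_def[abs_def])
  have Z_0: "Z 0 w = (x0 - xs, x0 - xs)" for w
    by (simp add: Z_def)
  have next_meas': "next_state \<in> measurable ((borel \<Otimes>\<^sub>M borel) \<Otimes>\<^sub>M borel) (borel \<Otimes>\<^sub>M borel)"
    using next_meas by (simp add: borel_prod)
  have z0: "(x0 - xs, x0 - xs) \<in> space (borel \<Otimes>\<^sub>M borel)"
    by (simp add: space_pair_measure)
  note Z_recursion = nn_integral_random_recursion[where Z = Z, OF G_indep next_meas' z0 Z_0 Z_Suc]

  define F where "F k = (\<integral>w. (norm (x k w - xs))\<^sup>2 \<partial>M)" for k
  define C where "C = 2 * \<alpha>\<^sup>2 * \<beta>1 * (norm r)\<^sup>2"
  \<comment> \<open>Integrability is propagated together with the recurrence: the bound on the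
    extended nonnegative integral is finite.\<close>
  have F_step: "integrable M (\<lambda>w. (norm (x (Suc (Suc k)) w - xs))\<^sup>2)"
      "F (Suc (Suc k)) \<le> \<gamma>1 * F (Suc k) + \<gamma>2 * F k + C"
    if int: "integrable M (\<lambda>w. (norm (x k w - xs))\<^sup>2)"
      "integrable M (\<lambda>w. (norm (x (Suc k) w - xs))\<^sup>2)" for k
  proof -
    define h where "h p = ennreal ((norm (snd (next_state p)))\<^sup>2)" for p
    note next_meas' [measurable]
    have h_meas: "h \<in> borel_measurable ((borel \<Otimes>\<^sub>M borel) \<Otimes>\<^sub>M borel)"
      unfolding h_def by measurable
    have Z_meas: "Z (Suc k) \<in> measurable M (borel \<Otimes>\<^sub>M borel)"
      by (rule Z_recursion(1))
    have x_eq: "x (Suc (Suc k)) w - xs = snd (next_state (Z k w, G (Suc k) w))" if "w \<in> space M" for w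
      using Z_eq[OF that, of "Suc k"] by (simp flip: Z_Suc)
    have snd_meas: "(\<lambda>w. snd (Z (Suc k) w)) \<in> borel_measurable M"
      using Z_meas by measurable
    have x_meas: "(\<lambda>w. (norm (x (Suc (Suc k)) w - xs))\<^sup>2) \<in> borel_measurable M"
      using snd_meas by (subst measurable_cong[where g = "\<lambda>w. (norm (snd (Z (Suc k) w)))\<^sup>2"])
        (simp_all add: Z_eq)
    \<comment> \<open>The state is frozen at \<open>(u, v)\<close> and only the fresh matrix is
      averaged, so the one-step estimate applies.\<close>
    have inner: "(\<integral>\<^sup>+ w'. h ((u, v), G (Suc k) w') \<partial>M) \<le> ennreal (R r u v)" for u v
    proof -
      note S = step[of "Suc k" r v u]
      have "(\<integral>\<^sup>+ w'. h ((u, v), G (Suc k) w') \<partial>M)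
          = ennreal (\<integral>w'. (norm (v - \<alpha> *\<^sub>R (G (Suc k) w' *v (A *v v + r)) + \<omega> *\<^sub>R (v - u)))\<^sup>2 \<partial>M)"
        unfolding h_def next_state_def using S(1) r by (simp add: nn_integral_eq_integral)
      also have "\<dots> \<le> ennreal (R r u v)"
        using S(2) r by (intro ennreal_leI) simp
      finally show ?thesis .
    qed
    have intR: "integrable M (\<lambda>w. R r (x k w - xs) (x (Suc k) w - xs))"
      unfolding R_def using int by simp
    have ER: "(\<integral>w. R r (x k w - xs) (x (Suc k) w - xs) \<partial>M) = \<gamma>1 * F (Suc k) + \<gamma>2 * F k + C"
      unfolding R_def F_def C_def using int by (simp add: prob_space)
    have "(\<integral>\<^sup>+ w. ennreal ((norm (x (Suc (Suc k)) w - xs))\<^sup>2) \<partial>M) = (\<integral>\<^sup>+ w. h (Z k w, G (Suc k) w) \<partial>M)"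
      by (intro nn_integral_cong) (simp add: h_def x_eq)
    also have "\<dots> = (\<integral>\<^sup>+ w. (\<integral>\<^sup>+ w'. h (Z k w, G (Suc k) w') \<partial>M) \<partial>M)"
      by (rule Z_recursion(2)[OF h_meas])
    also have "\<dots> \<le> (\<integral>\<^sup>+ w. ennreal (R r (x k w - xs) (x (Suc k) w - xs)) \<partial>M)"
      by (intro nn_integral_mono) (simp only: Z_eq inner)
    also have "\<dots> = ennreal (\<gamma>1 * F (Suc k) + \<gamma>2 * F k + C)"
      unfolding ER[symmetric] using R_nonneg[OF r] by (intro nn_integral_eq_integral intR) simp
    finally have le: "(\<integral>\<^sup>+ w. ennreal ((norm (x (Suc (Suc k)) w - xs))\<^sup>2) \<partial>M)
        \<le> ennreal (\<gamma>1 * F (Suc k) + \<gamma>2 * F k + C)" .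
    show int': "integrable M (\<lambda>w. (norm (x (Suc (Suc k)) w - xs))\<^sup>2)"
      using le x_meas by (intro integrableI_bounded) (auto simp: top_unique less_top[symmetric])
    have "0 \<le> \<gamma>1 * F (Suc k) + \<gamma>2 * F k + C"
      unfolding ER[symmetric] using R_nonneg[OF r] by simp
    moreover have "ennreal (F (Suc (Suc k))) \<le> ennreal (\<gamma>1 * F (Suc k) + \<gamma>2 * F k + C)"
      using le int' by (simp add: F_def nn_integral_eq_integral)
    ultimately show "F (Suc (Suc k)) \<le> \<gamma>1 * F (Suc k) + \<gamma>2 * F k + C"
      by simp
  qed
  have int: "integrable M (\<lambda>w. (norm (x k w - xs))\<^sup>2) \<and> integrable M (\<lambda>w. (norm (x (Suc k) w - xs))\<^sup>2)" for k
  proof (induction k)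
    case 0
    then show ?case
      using x_0 x_1 by (simp cong: Bochner_Integration.integrable_cong)
  next
    case (Suc k)
    then show ?case using F_step(1) by blast
  qed
  have F0: "F 0 = (norm (x0 - xs))\<^sup>2" "F 1 = F 0"
    using x_0 x_1 by (simp_all add: F_def prob_space cong: Bochner_Integration.integral_cong)
  \<comment> \<open>Here \<open>\<gamma>1 = q - \<tau>\<close> and
    \<open>\<gamma>2 = q * \<tau>\<close>, which is the form of the scalar recurrence with
    \<open>t = \<tau>\<close>.\<close>
  have F_bound: "F (Suc k) \<le> q ^ k * (1 + \<tau>) * F 0 + C * (1 - q ^ k) / (1 - q)" for k
  proof (rule two_term_recurrence_bound)
    show "F (Suc (Suc k)) \<le> (q - \<tau>) * F (Suc k) + q * \<tau> * F k + C" for k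
      using F_step(2) int[of k] by (simp add: q_tau) (simp add: tau)
    show "0 \<le> F k" for k
      by (simp add: F_def)
  qed (use q0 q1 tau0 F0 in auto)
  have "F (k + 1) \<le> q ^ k * (1 + \<tau>) * (norm (x0 - xs))\<^sup>2
      + 2 * \<alpha>\<^sup>2 * \<beta>1 * (1 - q ^ k) * (norm r)\<^sup>2 / (1 - q)" for k
    using F_bound[of k] by (simp add: F0(1) C_def mult_ac)
  moreover have "integrable M (\<lambda>w. (norm (x (k + 1) w - xs))\<^sup>2)" for k
    using int[of "k + 1"] by blast
  ultimately show ?thesis
    using tau0 sum_le q1 unfolding F_def r_def xs_def by blast
qed

end
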